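(* Let $N \ge 1$ and $m > 1$ be integers, let $x_j = \cos(j\pi/N)$ for $j = 0, 1, \ldots, N$, and let $y(x_0), \ldots, y(x_N)$ be real numbers. Let $$y(x) = \sum_{n=0}^{N}{}'' a_n T_n(x), \qquad a_n = \frac{2}{N} \sum_{j=0}^{N}{}'' y(x_j)\, T_n(x_j),$$ be the associated Chebyshev approximation polynomial. Then its $m$-th derivative at the nodes satisfies $$y^{(m)}(x_k) = \sum_{j=0}^{N} d_{k,j}^{(m)}\, y(x_j), \qquad k = 0, 1, \ldots, N,$$ where, for $k, j = 0, 1, \ldots, N$, $$d_{k,j}^{(m)} = \frac{\theta_j}{N} \sum_{n=0}^{N} \ \sum_{\substack{0 \le l \le n-m \\ n+l+m \text{ even}}} \left( \prod_{i \in I_m} \bigl(n^2 - (l+i)^2\bigr) \right) \frac{\theta_n\, n}{c_l}\, \frac{1}{(m-1)!\, 2^{m-3}}\, T_n(x_j)\, T_l(x_k).$$ Here $I_m = \{2-m,\ 4-m,\ \ldots,\ m-4,\ m-2\}$ (the integers from $2-m$ to $m-2$ in steps of two), $\theta_0 = \theta_N = \tfrac12$ and $\theta_j = 1$ for $1 \le j \le N-1$, and $c_0 = 2$, $c_l = 1$ for $l \ge 1$.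
   Context: The Chebyshev polynomials of the first kind are defined by $T_n(x) = \cos(n\theta)$ with $x = \cos\theta$, $\theta \in [0,\pi]$, $n \ge 0$. The symbol $\sum''$ denotes a sum in which the first and the last terms are multiplied by $\tfrac12$. An empty sum (when $n < m$) equals $0$. For $m = 2$ the index set is $I_2 = \{0\}$, and the factor $2^{m-3}$ is $2^{-1}$. *)

theory Defs
  imports "HOL-Analysis.Analysis" "HOL-Computational_Algebra.Polynomial"
begin

text \<open>
  The relation \<open>T\<^sub>n(cos \<theta>) = cos (n\<theta>)\<close> prescribes \<open>T\<^sub>n\<close> only on \<open>[-1, 1]\<close>; \<open>T\<^sub>n\<close> is the
  unique real polynomial satisfying it. This makes derivatives at the end points \<open>\<plusminus>1\<close> meaningful.
\<close>

definition chebyshev_poly :: "nat \<Rightarrow> real poly" where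
  "chebyshev_poly n = (THE p. \<forall>\<theta>\<in>{0..pi}. poly p (cos \<theta>) = cos (real n * \<theta>))"

lemma chebyshev_poly_ex1:
  "\<exists>!p :: real poly. \<forall>\<theta>\<in>{0..pi}. poly p (cos \<theta>) = cos (real n * \<theta>)"
proof (rule ex_ex1I)
  show "\<exists>p :: real poly. \<forall>\<theta>\<in>{0..pi}. poly p (cos \<theta>) = cos (real n * \<theta>)"
  proof (induction n rule: induct_nat_012)
    case 0
    show ?case by (intro exI[of _ 1]) simp
  next
    case 1
    show ?case by (intro exI[of _ "[:0, 1:]"]) simp
  next
    case (ge2 n)
    then obtain p q :: "real poly" where
      p: "\<forall>\<theta>\<in>{0..pi}. poly p (cos \<theta>) = cos (real n * \<theta>)" and
      q: "\<forall>\<theta>\<in>{0..pi}. poly q (cos \<theta>) = cos (real (Suc n) * \<theta>)"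
      by blast
    have "cos (real (Suc (Suc n)) * t) = 2 * cos t * cos (real (Suc n) * t) - cos (real n * t)"
      for t :: real
    proof -
      have "cos (real (Suc (Suc n)) * t) = cos (real (Suc n) * t + t)"
        "cos (real n * t) = cos (real (Suc n) * t - t)"
        by (simp_all add: algebra_simps)
      then show ?thesis
        by (simp only: cos_add cos_diff) (simp add: algebra_simps)
    qed
    with p q show ?case
      by (intro exI[of _ "[:0, 2:] * q - p"]) simp
  qed
next
  fix p q :: "real poly"
  assume p: "\<forall>\<theta>\<in>{0..pi}. poly p (cos \<theta>) = cos (real n * \<theta>)"
    and q: "\<forall>\<theta>\<in>{0..pi}. poly q (cos \<theta>) = cos (real n * \<theta>)"
  have "{-1..1} \<subseteq> {x. poly (p - q) x = 0}"
  proof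
    fix x :: real
    assume "x \<in> {-1..1}"
    then have "x = cos (arccos x)" "arccos x \<in> {0..pi}"
      by (auto simp: arccos_lbound arccos_ubound)
    with p q show "x \<in> {x. poly (p - q) x = 0}"
      by (metis (mono_tags, lifting) mem_Collect_eq poly_diff right_minus_eq)
  qed
  moreover have "infinite {-1..1::real}"
    by (simp add: infinite_Icc)
  ultimately have "infinite {x. poly (p - q) x = 0}"
    using finite_subset by blast
  then show "p = q"
    using poly_roots_finite[of "p - q"] by auto
qed

lemma poly_chebyshev_poly_cos:
  "\<theta> \<in> {0..pi} \<Longrightarrow> poly (chebyshev_poly n) (cos \<theta>) = cos (real n * \<theta>)"
  using theI'[OF chebyshev_poly_ex1, of n] unfolding chebyshev_poly_def by blast

definition chebyshev_T :: "nat \<Rightarrow> real \<Rightarrow> real" where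
  "chebyshev_T n x = poly (chebyshev_poly n) x"

definition cheb_node :: "nat \<Rightarrow> nat \<Rightarrow> real" where
  "cheb_node N j = cos (real j * pi / real N)"

text \<open>The sum \<open>\<Sum>''\<close> over \<open>0, \<dots>, N\<close>, with first and last terms halved (for \<open>N \<ge> 1\<close>).\<close>

definition sum_halved :: "nat \<Rightarrow> (nat \<Rightarrow> real) \<Rightarrow> real" where
  "sum_halved N f = (\<Sum>n=0..N. if n = 0 \<or> n = N then f n / 2 else f n)"

text \<open>Below, \<open>u j\<close> is the given value \<open>y(x\<^sub>j)\<close>.\<close>

definition cheb_coeff :: "nat \<Rightarrow> (nat \<Rightarrow> real) \<Rightarrow> nat \<Rightarrow> real" where
  "cheb_coeff N u n =
     2 / real N * sum_halved N (\<lambda>j. u j * chebyshev_T n (cheb_node N j))"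

definition cheb_approx :: "nat \<Rightarrow> (nat \<Rightarrow> real) \<Rightarrow> real \<Rightarrow> real" where
  "cheb_approx N u x = sum_halved N (\<lambda>n. cheb_coeff N u n * chebyshev_T n x)"

definition theta :: "nat \<Rightarrow> nat \<Rightarrow> real" where
  "theta N j = (if j = 0 \<or> j = N then 1 / 2 else 1)"

definition cheb_c :: "nat \<Rightarrow> real" where
  "cheb_c l = (if l = 0 then 2 else 1)"

definition index_I :: "nat \<Rightarrow> int set" where
  "index_I m = {i \<in> {2 - int m..int m - 2}. even (i - (2 - int m))}"

definition cheb_diff_coeff :: "nat \<Rightarrow> nat \<Rightarrow> nat \<Rightarrow> nat \<Rightarrow> real" where
  "cheb_diff_coeff N m k j =
     theta N j / real N *
     (\<Sum>n=0..N. \<Sum>l | l + m \<le> n \<and> even (n + l + m).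
        (\<Prod>i\<in>index_I m. (real n)\<^sup>2 - (real l + real_of_int i)\<^sup>2) *
        (theta N n * real n / cheb_c l) *
        (1 / (fact (m - 1) * 2 powi (int m - 3))) *
        chebyshev_T n (cheb_node N j) * chebyshev_T l (cheb_node N k))"

end

theory Submission
  imports Defs
begin

text \<open>
  It suffices to expand each \<open>T\<^sub>n\<^sup>(\<^sup>m\<^sup>)\<close> in the basis \<open>T\<^sub>0, T\<^sub>1, \<dots>\<close>; the formula for
  \<open>d\<^sub>k\<^sub>,\<^sub>j\<close> then follows by inserting the definition of \<open>a\<^sub>n\<close> and exchanging sums.

  With the polynomials of the second kind, \<open>T\<^sub>l' = l U\<^sub>l\<^sub>-\<^sub>1\<close> and \<open>2 T\<^sub>l = U\<^sub>l - U\<^sub>l\<^sub>-\<^sub>2\<close>. Hence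
  \<open>\<Sum> (b'\<^sub>l / c\<^sub>l) T\<^sub>l\<close> is the derivative of \<open>\<Sum> (b\<^sub>l / c\<^sub>l) T\<^sub>l\<close> as soon as
  \<open>b'\<close> has finite support and \<open>b'\<^sub>l\<^sub>-\<^sub>1 - b'\<^sub>l\<^sub>+\<^sub>1 = 2 l b\<^sub>l\<close> for \<open>l \<ge> 1\<close> (lemma \<open>pderiv_chebyshev_sum\<close>).

  Writing \<open>m = k + 1\<close> and
  \<open>n = l + m + 2r\<close>, the factors of the product over \<open>I\<^sub>m\<close> split as
  \<open>n\<^sup>2 - (l + i)\<^sup>2 = (n - l - i) (n + l + i)\<close>, and the product becomes
  \<open>4\<^sup>k (r + 1)\<^sub>k (l + r + 1)\<^sub>k\<close> with rising factorials. In this form the recurrence from \<open>m\<close> to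
  \<open>m + 1\<close> (lemma \<open>cheb_deriv_coeff_Suc_rec\<close>) reduces to the identity
  \<open>(r + 1 + k) (l + r) - r (l + r + 1 + k) = (k + 1) l\<close>, so the expansion of the derivatives
  (lemma \<open>higher_pderiv_chebyshev_poly\<close>) follows by induction on \<open>m\<close>.
\<close>

section \<open>Chebyshev polynomials of the first and second kind\<close>

lemma chebyshev_poly_unique:
  assumes "\<And>t. t \<in> {0..pi} \<Longrightarrow> poly p (cos t) = cos (real n * t)"
  shows "chebyshev_poly n = p"
  using chebyshev_poly_ex1[of n] assms poly_chebyshev_poly_cos[of _ n] by blast

lemma chebyshev_poly_0: "chebyshev_poly 0 = 1"
  by (rule chebyshev_poly_unique) simp

lemma chebyshev_poly_1: "chebyshev_poly (Suc 0) = [:0, 1:]"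
  by (rule chebyshev_poly_unique) simp

lemma chebyshev_poly_Suc_Suc:
  "chebyshev_poly (Suc (Suc n)) = [:0, 2:] * chebyshev_poly (Suc n) - chebyshev_poly n"
proof (rule chebyshev_poly_unique)
  fix t :: real
  assume t: "t \<in> {0..pi}"
  have "cos (real (Suc (Suc n)) * t) = cos (real (Suc n) * t + t)"
    "cos (real n * t) = cos (real (Suc n) * t - t)"
    by (simp_all add: algebra_simps)
  then have "cos (real (Suc (Suc n)) * t) = 2 * cos t * cos (real (Suc n) * t) - cos (real n * t)"
    by (simp only: cos_add cos_diff) (simp add: algebra_simps)
  with t show "poly ([:0, 2:] * chebyshev_poly (Suc n) - chebyshev_poly n) (cos t)
      = cos (real (Suc (Suc n)) * t)"
    by (simp add: poly_chebyshev_poly_cos del: of_nat_Suc)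
qed

text \<open>The Chebyshev polynomials \<open>U\<^sub>n\<close> of the second kind, given by their three-term recurrence.\<close>

fun chebyshev_U_poly :: "nat \<Rightarrow> real poly" where
  "chebyshev_U_poly 0 = 1"
| "chebyshev_U_poly (Suc 0) = [:0, 2:]"
| "chebyshev_U_poly (Suc (Suc n)) = [:0, 2:] * chebyshev_U_poly (Suc n) - chebyshev_U_poly n"

lemma chebyshev_poly_conv_U:
  "smult 2 (chebyshev_poly (Suc (Suc n))) = chebyshev_U_poly (Suc (Suc n)) - chebyshev_U_poly n"
proof (induction n rule: induct_nat_012)
  case 0
  show ?case by (simp add: chebyshev_poly_Suc_Suc chebyshev_poly_0 chebyshev_poly_1 one_pCons numeral_poly)
next
  case 1
  show ?case by (simp add: chebyshev_poly_Suc_Suc chebyshev_poly_0 chebyshev_poly_1 one_pCons numeral_poly)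
next
  case (ge2 n)
  have "smult 2 (chebyshev_poly (Suc (Suc (Suc (Suc n)))))
    = [:0, 2:] * smult 2 (chebyshev_poly (Suc (Suc (Suc n)))) - smult 2 (chebyshev_poly (Suc (Suc n)))"
    by (subst chebyshev_poly_Suc_Suc) (simp only: smult_diff_right mult_smult_right)
  also have "\<dots> = chebyshev_U_poly (Suc (Suc (Suc (Suc n)))) - chebyshev_U_poly (Suc (Suc n))"
    unfolding ge2.IH chebyshev_U_poly.simps by (simp only: algebra_simps)
  finally show ?case .
qed

lemma pderiv_chebyshev_poly_Suc:
  "pderiv (chebyshev_poly (Suc n)) = smult (real (Suc n)) (chebyshev_U_poly n)"
proof (rule poly_eq_poly_eq_iff[THEN iffD1, OF ext])
  fix x :: real
  show "poly (pderiv (chebyshev_poly (Suc n))) x = poly (smult (real (Suc n)) (chebyshev_U_poly n)) x"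
  proof (induction n rule: induct_nat_012)
    case 0
    show ?case by (simp add: chebyshev_poly_1 pderiv_pCons)
  next
    case 1
    show ?case
      by (simp add: chebyshev_poly_Suc_Suc chebyshev_poly_0 chebyshev_poly_1 pderiv_pCons
          pderiv_mult pderiv_diff)
  next
    case (ge2 n)
    have T: "2 * poly (chebyshev_poly (Suc (Suc n))) x
        = poly (chebyshev_U_poly (Suc (Suc n))) x - poly (chebyshev_U_poly n) x"
      using arg_cong[OF chebyshev_poly_conv_U[of n], of "\<lambda>p. poly p x"]
      by (simp only: poly_smult poly_diff)
    have "poly (pderiv (chebyshev_poly (Suc (Suc (Suc n))))) x
      = 2 * poly (chebyshev_poly (Suc (Suc n))) x
        + 2 * x * poly (pderiv (chebyshev_poly (Suc (Suc n)))) x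
        - poly (pderiv (chebyshev_poly (Suc n))) x"
      by (subst chebyshev_poly_Suc_Suc) (simp add: pderiv_diff pderiv_mult pderiv_pCons pderiv_smult)
    then show ?case
      unfolding T ge2.IH by (simp add: algebra_simps)
  qed
qed

section \<open>Differentiating Chebyshev sums\<close>

text \<open>
  Conversion of a Chebyshev sum to the basis \<open>U\<^sub>0, U\<^sub>1, \<dots>\<close>. The last two terms have no partner
  \<open>b\<^sub>l\<^sub>+\<^sub>2\<close>; they vanish if \<open>b\<close> is zero from \<open>M\<close> on.
\<close>

lemma sum_chebyshev_poly_conv_U:
  "smult 2 (\<Sum>l\<le>Suc M. smult (b l / cheb_c l) (chebyshev_poly l))
    = (\<Sum>l<M. smult (b l - b (Suc (Suc l))) (chebyshev_U_poly l))
      + smult (b M) (chebyshev_U_poly M) + smult (b (Suc M)) (chebyshev_U_poly (Suc M))"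
proof (induction M)
  case 0
  show ?case by (simp add: cheb_c_def chebyshev_poly_0 chebyshev_poly_1)
next
  case (Suc M)
  have "smult 2 (smult (b (Suc (Suc M)) / cheb_c (Suc (Suc M))) (chebyshev_poly (Suc (Suc M))))
    = smult (b (Suc (Suc M))) (chebyshev_U_poly (Suc (Suc M)) - chebyshev_U_poly M)"
    unfolding chebyshev_poly_conv_U[symmetric] by (simp add: cheb_c_def mult.commute)
  then show ?case
    unfolding sum.atMost_Suc[of _ "Suc M"] smult_add_right Suc.IH
    by (simp add: smult_diff_right smult_diff_left del: chebyshev_U_poly.simps)
qed

lemma pderiv_chebyshev_sum:
  assumes rec: "\<And>l. l < n \<Longrightarrow> b' l - b' (Suc (Suc l)) = 2 * real (Suc l) * b (Suc l)"
    and zero: "\<And>l. l \<ge> n \<Longrightarrow> b' l = 0"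
  shows "pderiv (\<Sum>l\<le>n. smult (b l / cheb_c l) (chebyshev_poly l))
    = (\<Sum>l\<le>n. smult (b' l / cheb_c l) (chebyshev_poly l))"
proof -
  have "smult 2 (\<Sum>l\<le>n. smult (b' l / cheb_c l) (chebyshev_poly l))
      = smult 2 (\<Sum>l\<le>Suc n. smult (b' l / cheb_c l) (chebyshev_poly l))"
    by (simp add: zero)
  also have "\<dots> = (\<Sum>l<n. smult (b' l - b' (Suc (Suc l))) (chebyshev_U_poly l))"
    unfolding sum_chebyshev_poly_conv_U by (simp add: zero)
  also have "\<dots> = (\<Sum>l<n. smult 2 (smult (b (Suc l)) (pderiv (chebyshev_poly (Suc l)))))"
    by (intro sum.cong refl) (simp add: rec pderiv_chebyshev_poly_Suc mult_ac del: of_nat_Suc)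
  also have "\<dots> = smult 2 (\<Sum>l\<le>n. smult (b l / cheb_c l) (pderiv (chebyshev_poly l)))"
    by (subst sum.atMost_shift, rule poly_eqI)
      (simp add: chebyshev_poly_0 cheb_c_def coeff_sum sum_distrib_left mult.assoc)
  also have "(\<Sum>l\<le>n. smult (b l / cheb_c l) (pderiv (chebyshev_poly l)))
      = pderiv (\<Sum>l\<le>n. smult (b l / cheb_c l) (chebyshev_poly l))"
    by (simp add: higher_pderiv_sum[of 1, simplified] pderiv_smult)
  finally show ?thesis by (simp add: poly_eq_iff)
qed

section \<open>The coefficients of the derivatives of a Chebyshev polynomial\<close>

text \<open>
  The coefficient of \<open>T\<^sub>l / c\<^sub>l\<close> in the derivative of order \<open>k + 1\<close> of \<open>T\<^sub>n\<close>. The order is shifted by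
  one since the closed form makes no sense for order \<open>0\<close>. The variable \<open>r\<close> is determined by
  \<open>n = l + (k + 1) + 2r\<close>.
\<close>

definition cheb_deriv_coeff :: "nat \<Rightarrow> nat \<Rightarrow> nat \<Rightarrow> real" where
  "cheb_deriv_coeff k n l =
    (if Suc (l + k) \<le> n \<and> even (n + l + Suc k)
     then let r = real ((n - Suc (l + k)) div 2)
       in real n * 2 ^ Suc k * pochhammer (r + 1) k * pochhammer (real l + r + 1) k / fact k
     else 0)"

lemma cheb_deriv_coeff_eq:
  assumes "n = l + Suc k + 2 * r"
  shows "cheb_deriv_coeff k n l
    = real n * 2 ^ Suc k * pochhammer (real r + 1) k * pochhammer (real l + real r + 1) k / fact k"
proof -
  have "Suc (l + k) \<le> n" "even (n + l + Suc k)" "(n - Suc (l + k)) div 2 = r"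
    using assms by auto
  then show ?thesis by (simp add: cheb_deriv_coeff_def Let_def)
qed

text \<open>
  The recurrence that starts the induction: on the right stand the coefficients of \<open>T\<^sub>n\<close> itself.
\<close>

lemma cheb_deriv_coeff_0_rec:
  assumes "l < n"
  shows "cheb_deriv_coeff 0 n l - cheb_deriv_coeff 0 n (Suc (Suc l))
    = 2 * real (Suc l) * (if Suc l = n then 1 else 0)"
  using assms by (cases "n = Suc (Suc l)") (auto simp: cheb_deriv_coeff_def Let_def)

lemma cheb_deriv_coeff_Suc_rec:
  "cheb_deriv_coeff (Suc k) n l - cheb_deriv_coeff (Suc k) n (Suc (Suc l))
    = 2 * real (Suc l) * cheb_deriv_coeff k n (Suc l)"
proof (cases "Suc (Suc l + k) \<le> n \<and> even (n + Suc l + Suc k)")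
  case False
  then show ?thesis by (auto simp: cheb_deriv_coeff_def)
next
  case True
  then obtain r where r: "n = Suc l + Suc k + 2 * r"
  proof -
    have "even (n - (Suc l + Suc k))" using True by auto
    then obtain r where "n - (Suc l + Suc k) = 2 * r" by (elim evenE)
    with True that show thesis by (metis add_Suc_right le_add_diff_inverse)
  qed
  \<comment> \<open>Both coefficients on the left are multiples of the one on the right. Passing from \<open>l\<close> to
    \<open>l + 2\<close> lowers \<open>r\<close> by one; for \<open>r = 0\<close> the upper coefficient is zero by definition.\<close>
  define A B where "A = pochhammer (real r + 1) k" and "B = pochhammer (real (Suc l) + real r + 1) k"
  define C where "C = real n * 2 ^ Suc k / fact k"
  have mid: "cheb_deriv_coeff k n (Suc l) = C * A * B"
    by (subst cheb_deriv_coeff_eq[OF r]) (simp add: A_def B_def C_def)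
  have lower: "cheb_deriv_coeff (Suc k) n l
      = C * A * B * (2 / (real k + 1)) * ((real r + 1 + real k) * (real (Suc l) + real r))"
  proof -
    have "pochhammer (real l + real r + 1) (Suc k) = (real (Suc l) + real r) * B"
      by (simp add: B_def pochhammer_rec add_ac)
    moreover have "pochhammer (real r + 1) (Suc k) = (real r + 1 + real k) * A"
      by (simp add: A_def pochhammer_rec')
    ultimately show ?thesis
      by (subst cheb_deriv_coeff_eq[of n l "Suc k" r])
        (simp_all add: r C_def field_simps del: of_nat_Suc of_nat_add, simp add: algebra_simps)
  qed
  have upper: "cheb_deriv_coeff (Suc k) n (Suc (Suc l))
      = C * A * B * (2 / (real k + 1)) * (real r * (real (Suc l) + real r + 1 + real k))"
  proof (cases r)
    case 0
    then show ?thesis using r by (simp add: cheb_deriv_coeff_def)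
  next
    case (Suc s)
    have "pochhammer (real (Suc (Suc l)) + real s + 1) (Suc k)
        = (real (Suc l) + real r + 1 + real k) * B"
      by (simp add: B_def Suc pochhammer_rec' add_ac)
    moreover have "pochhammer (real s + 1) (Suc k) = real r * A"
      by (simp add: A_def Suc pochhammer_rec add_ac)
    ultimately show ?thesis
      by (subst cheb_deriv_coeff_eq[of n "Suc (Suc l)" "Suc k" s])
        (simp_all add: r Suc C_def field_simps del: of_nat_Suc of_nat_add, simp add: algebra_simps)
  qed
  have "(real r + 1 + real k) * (real (Suc l) + real r) - real r * (real (Suc l) + real r + 1 + real k)
      = (real k + 1) * real (Suc l)"
    by (simp add: algebra_simps)
  then show ?thesis
    unfolding mid lower upper right_diff_distrib[symmetric] by (simp add: field_simps)
qed

lemma higher_pderiv_chebyshev_poly: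
  "(pderiv ^^ Suc k) (chebyshev_poly n)
    = (\<Sum>l\<le>n. smult (cheb_deriv_coeff k n l / cheb_c l) (chebyshev_poly l))"
proof (induction k)
  case 0
  show ?case
  proof (cases n)
    case 0
    then show ?thesis by (simp add: chebyshev_poly_0 cheb_deriv_coeff_def)
  next
    case (Suc n')
    \<comment> \<open>Since \<open>n > 0\<close> here, \<open>c\<^sub>n = 1\<close>, and \<open>T\<^sub>n\<close> has the coefficients \<open>b\<^sub>l = \<delta>\<^sub>l\<^sub>n\<close>.\<close>
    let ?b = "\<lambda>l. if l = n then 1 else (0::real)"
    have "(\<Sum>l\<le>n. smult (?b l / cheb_c l) (chebyshev_poly l))
        = (\<Sum>l\<le>n. if l = n then chebyshev_poly l else 0)"
      using Suc by (intro sum.cong) (auto simp: cheb_c_def)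
    also have "\<dots> = chebyshev_poly n" by simp
    finally show ?thesis
      using pderiv_chebyshev_sum[of n "cheb_deriv_coeff 0 n" ?b] cheb_deriv_coeff_0_rec[of _ n]
      by (simp add: cheb_deriv_coeff_def)
  qed
next
  case (Suc k)
  have "(pderiv ^^ Suc (Suc k)) (chebyshev_poly n)
      = pderiv (\<Sum>l\<le>n. smult (cheb_deriv_coeff k n l / cheb_c l) (chebyshev_poly l))"
    using Suc.IH by simp
  also have "\<dots> = (\<Sum>l\<le>n. smult (cheb_deriv_coeff (Suc k) n l / cheb_c l) (chebyshev_poly l))"
    by (rule pderiv_chebyshev_sum) (rule cheb_deriv_coeff_Suc_rec, simp add: cheb_deriv_coeff_def)
  finally show ?case .
qed

section \<open>The product over the index set\<close>

lemma index_I_Suc: "index_I (Suc k) = (\<lambda>t. 2 * int t + 1 - int k) ` {..<k}"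
proof (intro equalityI subsetI)
  fix i assume "i \<in> index_I (Suc k)"
  then have i: "1 - int k \<le> i" "i \<le> int k - 1" "even (i - (1 - int k))"
    by (auto simp: index_I_def)
  from i(3) obtain q where q: "i - (1 - int k) = 2 * q" by (elim evenE)
  with i have "i = 2 * int (nat q) + 1 - int k" "nat q < k" by auto
  then show "i \<in> (\<lambda>t. 2 * int t + 1 - int k) ` {..<k}" by blast
qed (auto simp: index_I_def)

lemma prod_index_I:
  assumes n: "n = l + Suc k + 2 * r"
  shows "(\<Prod>i\<in>index_I (Suc k). (real n)\<^sup>2 - (real l + real_of_int i)\<^sup>2)
    = 4 ^ k * pochhammer (real r + 1) k * pochhammer (real l + real r + 1) k"
proof -
  have "(\<Prod>i\<in>index_I (Suc k). (real n)\<^sup>2 - (real l + real_of_int i)\<^sup>2)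
      = (\<Prod>t<k. (real n)\<^sup>2 - (real l + (2 * real t + 1 - real k))\<^sup>2)"
    unfolding index_I_Suc by (subst prod.reindex) (auto simp: inj_on_def)
  also have "\<dots> = (\<Prod>t<k. 4 * ((real r + real k - real t) * (real l + real r + 1 + real t)))"
    by (intro prod.cong refl) (simp add: n power2_eq_square algebra_simps)
  also have "\<dots> = 4 ^ k * ((\<Prod>t<k. real r + real k - real t) * (\<Prod>t<k. real l + real r + 1 + real t))"
    by (simp add: prod.distrib)
  also have "(\<Prod>t<k. real r + real k - real t) = (\<Prod>t<k. real r + 1 + real t)"
    by (subst prod.nat_diff_reindex[symmetric]) (auto intro!: prod.cong)
  finally show ?thesis
    by (simp add: pochhammer_prod lessThan_atLeast0)
qed

lemma cheb_deriv_coeff_conv_prod: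
  assumes "l + Suc k \<le> n" and "even (n + l + Suc k)"
  shows "2 * cheb_deriv_coeff k n l
    = (\<Prod>i\<in>index_I (Suc k). (real n)\<^sup>2 - (real l + real_of_int i)\<^sup>2) * real n
      * (1 / (fact k * 2 powi (int (Suc k) - 3)))"
proof -
  have "even (n - (l + Suc k))" using assms by auto
  then obtain r where "n - (l + Suc k) = 2 * r" by (elim evenE)
  then have r: "n = l + Suc k + 2 * r" using assms(1) by linarith
  have "(2::real) powi (int (Suc k) - 3) = 2 powi int k / 2 powi 2"
    by (subst power_int_diff[symmetric]) simp_all
  then have p: "(2::real) powi (int (Suc k) - 3) = 2 ^ k / 4" by simp
  have "(4::real) ^ k = 2 ^ k * 2 ^ k"
    by (simp flip: power_mult_distrib)
  then show ?thesis
    unfolding cheb_deriv_coeff_eq[OF r] prod_index_I[OF r] p by simp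
qed

section \<open>Derivatives of the approximation polynomial\<close>

lemma higher_deriv_poly: "(deriv ^^ m) (poly p) = poly ((pderiv ^^ m) (p :: real poly))"
  proof (induction m)
  case (Suc m)
  have "deriv (poly ((pderiv ^^ m) p)) = poly (pderiv ((pderiv ^^ m) p))"
    by (intro ext DERIV_imp_deriv poly_DERIV)
  with Suc show ?case by simp
qed simp

lemma higher_deriv_chebyshev_sum:
  "(deriv ^^ m) (\<lambda>x. \<Sum>n\<in>A. a n * chebyshev_T n x) x
    = (\<Sum>n\<in>A. a n * poly ((pderiv ^^ m) (chebyshev_poly n)) x)"
proof -
  have "(\<lambda>x. \<Sum>n\<in>A. a n * chebyshev_T n x) = poly (\<Sum>n\<in>A. smult (a n) (chebyshev_poly n))"
    by (simp add: fun_eq_iff chebyshev_T_def poly_sum)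
  then show ?thesis
    by (simp add: higher_deriv_poly higher_pderiv_sum higher_pderiv_smult poly_sum)
qed

lemma sum_halved_theta: "sum_halved N f = (\<Sum>n=0..N. theta N n * f n)"
  unfolding sum_halved_def theta_def by (intro sum.cong) auto

text \<open>The factor \<open>2\<close> is that of \<open>a\<^sub>n = (2 / N) \<Sum>'' \<dots>\<close>; it turns \<open>2\<^sup>m\<^sup>-\<^sup>2\<close> into \<open>2\<^sup>m\<^sup>-\<^sup>3\<close>.\<close>

lemma double_higher_deriv_chebyshev_T:
  assumes "m \<ge> 1"
  shows "2 * poly ((pderiv ^^ m) (chebyshev_poly n)) x =
    (\<Sum>l | l + m \<le> n \<and> even (n + l + m).
        (\<Prod>i\<in>index_I m. (real n)\<^sup>2 - (real l + real_of_int i)\<^sup>2) * (real n / cheb_c l)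
        * (1 / (fact (m - 1) * 2 powi (int m - 3))) * chebyshev_T l x)"
proof -
  obtain k where m: "m = Suc k" using assms by (cases m) auto
  have "2 * poly ((pderiv ^^ m) (chebyshev_poly n)) x
      = (\<Sum>l\<le>n. 2 * cheb_deriv_coeff k n l / cheb_c l * chebyshev_T l x)"
    unfolding m higher_pderiv_chebyshev_poly
    by (simp add: poly_sum sum_distrib_left chebyshev_T_def mult_ac)
  also have "\<dots> = (\<Sum>l | l + m \<le> n \<and> even (n + l + m).
      2 * cheb_deriv_coeff k n l / cheb_c l * chebyshev_T l x)"
    by (rule sum.mono_neutral_right) (auto simp: m cheb_deriv_coeff_def)
  finally show ?thesis
    by (auto simp: m cheb_deriv_coeff_conv_prod simp del: of_nat_Suc intro!: sum.cong)
qed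

theorem mainTheorem2:
  fixes N m :: nat and u :: "nat \<Rightarrow> real"
  assumes "N \<ge> 1" and "m > 1"
  shows "\<forall>k\<in>{0..N}.
    (deriv ^^ m) (cheb_approx N u) (cheb_node N k) =
      (\<Sum>j=0..N. cheb_diff_coeff N m k j * u j)"
proof
  fix k
  define x where "x = cheb_node N k"
  define D where "D n = poly ((pderiv ^^ m) (chebyshev_poly n)) x" for n
  have D: "2 * D n = (\<Sum>l | l + m \<le> n \<and> even (n + l + m).
        (\<Prod>i\<in>index_I m. (real n)\<^sup>2 - (real l + real_of_int i)\<^sup>2) * (real n / cheb_c l)
        * (1 / (fact (m - 1) * 2 powi (int m - 3))) * chebyshev_T l x)" for n
    unfolding D_def by (rule double_higher_deriv_chebyshev_T) (use assms in simp)
  have d: "cheb_diff_coeff N m k j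
      = theta N j / real N * (\<Sum>n=0..N. theta N n * chebyshev_T n (cheb_node N j) * (2 * D n))" for j
    unfolding cheb_diff_coeff_def D x_def[symmetric]
    by (intro arg_cong2[of _ _ _ _ "(*)"] refl sum.cong) (simp add: sum_distrib_left mult_ac)
  have "cheb_approx N u = (\<lambda>x. \<Sum>n=0..N. (theta N n * cheb_coeff N u n) * chebyshev_T n x)"
    by (simp add: fun_eq_iff cheb_approx_def sum_halved_theta mult.assoc)
  then have "(deriv ^^ m) (cheb_approx N u) x = (\<Sum>n=0..N. theta N n * cheb_coeff N u n * D n)"
    unfolding D_def by (simp only: higher_deriv_chebyshev_sum)
  also have "\<dots> = (\<Sum>n=0..N. \<Sum>j=0..N.
      theta N j / real N * (theta N n * chebyshev_T n (cheb_node N j) * (2 * D n)) * u j)"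
    unfolding cheb_coeff_def sum_halved_theta
    by (simp add: sum_distrib_left sum_distrib_right mult_ac)
  also have "\<dots> = (\<Sum>j=0..N. cheb_diff_coeff N m k j * u j)"
    unfolding d by (subst sum.swap) (simp add: sum_distrib_left sum_distrib_right)
  finally show "(deriv ^^ m) (cheb_approx N u) (cheb_node N k)
      = (\<Sum>j=0..N. cheb_diff_coeff N m k j * u j)"
    unfolding x_def .
qed

end
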